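(* Let $(X,f)$ be a dynamical system with $X$ a Hausdorff space, and assume that $X$ contains at least one isolated point. (a) If $(X,f)$ satisfies $\mathrm{TT}_+$, then $X$ is finite and consists of a single periodic orbit. In particular, $\mathrm{TT}_+$, $\mathrm{TT}_{++}$ and $\mathrm{DO}_{++}$ are equivalent for dynamical systems (on Hausdorff spaces) with isolated points, and each of them implies all of the conditions $\mathrm{IN}$, $\mathrm{TT}$, $\mathrm{TT}_+$, $\mathrm{TT}_{++}$, $\mathrm{DO}$, $\mathrm{DO}_+$, $\mathrm{DO}_{++}$. (b) If $(X,f)$ is topologically transitive (i.e. satisfies $\mathrm{TT}$), then the set of isolated points of $X$ is contained in a single orbit which is dense in $X$. In particular, $\mathrm{TT}$ is equivalent to $\mathrm{DO}$ for dynamical systems (on Hausdorff spaces) with isolated points.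
   Context: A dynamical system $(X,f)$ is a continuous map $f\colon X\to X$ on a nonempty topological space $X$. $\mathbb N$ is the set of nonnegative integers. For $A\subset X$, $k\in\mathbb Z$, $f^k(A)$ is the image of $A$ under $f^k$ if $k\ge 0$ and the preimage of $A$ under $f^{|k|}$ if $k<0$. A set is opene if it is open and nonempty. $A$ is $+$invariant if $f(A)\subset A$. A point $x$ is isolated if $\{x\}$ is open. For $x\in X$, $O(x)=\{f^k(x):k\in\mathbb N\}$ and $\omega f(x)=\bigcap_{n\ge0}\overline{\{f^k(x):k\ge n\}}$. For $A,B\subset X$: $N(A,B)=\{k\in\mathbb Z: A\cap f^{-k}(B)\ne\varnothing\}$ and $N_+(A,B)=N(A,B)\cap\mathbb N$. An orbit sequence is either a bi-infinite sequence $\langle x_k:k\in\mathbb Z\rangle$ with $f(x_k)=x_{k+1}$ for all $k$, or a sequence $\langle x_k:k\ge n\rangle$ (for some $n\in\mathbb Z$) with $f(x_k)=x_{k+1}$ for $k\ge n$ and $f^{-1}(\{x_n\})=\varnothing$. The set of elements of an orbit sequence is called an orbit. "$X$ consists of a single periodic orbit" means $X=O(x)$ for some $x$ with $f^p(x)=x$ for some $p\ge1$. Conditions on $(X,f)$: $\mathrm{IN}$: $X$ is not the union of two proper closed $+$invariant subsets. $\mathrm{TT}$: for all opene $U,V\subset X$, $N(U,V)\neq\varnothing$. $\mathrm{TT}_+$: for all opene $U,V\subset X$, $N_+(U,V)\ne\varnothing$. $\mathrm{TT}_{++}$: for all opene $U,V\subset X$, $N_+(U,V)$ is infinite. $\mathrm{DO}$: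 there is an orbit sequence in $X$ whose set of elements is dense in $X$. $\mathrm{DO}_+$: there is $x\in X$ with $O(x)$ dense in $X$. $\mathrm{DO}_{++}$: there is $x\in X$ with $\omega f(x)=X$. *)

theory Defs
  imports "HOL-Analysis.Analysis"
begin

text \<open>
  The space \<open>X\<close> is the universe of a type of class \<open>topological_space\<close> (hence nonempty);
  a dynamical system on it is a map \<open>f\<close> with \<open>continuous_on UNIV f\<close>.
\<close>

definition iter_set :: "('a \<Rightarrow> 'a) \<Rightarrow> int \<Rightarrow> 'a set \<Rightarrow> 'a set" where
  "iter_set f k A = (if k \<ge> 0 then (f ^^ nat k) ` A else (f ^^ nat (- k)) -` A)"

definition hit_times :: "('a \<Rightarrow> 'a) \<Rightarrow> 'a set \<Rightarrow> 'a set \<Rightarrow> int set" where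
  "hit_times f A B = {k. A \<inter> iter_set f (- k) B \<noteq> {}}"

definition hit_times_plus :: "('a \<Rightarrow> 'a) \<Rightarrow> 'a set \<Rightarrow> 'a set \<Rightarrow> int set" where
  "hit_times_plus f A B = hit_times f A B \<inter> \<nat>"

definition plus_invariant :: "('a \<Rightarrow> 'a) \<Rightarrow> 'a set \<Rightarrow> bool" where
  "plus_invariant f A \<longleftrightarrow> f ` A \<subseteq> A"

definition forward_orbit :: "('a \<Rightarrow> 'a) \<Rightarrow> 'a \<Rightarrow> 'a set" where
  "forward_orbit f x = {(f ^^ k) x |k. True}"

definition omega_limit :: "('a::topological_space \<Rightarrow> 'a) \<Rightarrow> 'a \<Rightarrow> 'a set" where
  "omega_limit f x = (\<Inter>n. closure {(f ^^ k) x |k. k \<ge> n})"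

definition opene :: "'a::topological_space set \<Rightarrow> bool" where
  "opene U \<longleftrightarrow> open U \<and> U \<noteq> {}"

definition bi_orbit_seq :: "('a \<Rightarrow> 'a) \<Rightarrow> (int \<Rightarrow> 'a) \<Rightarrow> bool" where
  "bi_orbit_seq f x \<longleftrightarrow> (\<forall>k. f (x k) = x (k + 1))"

text \<open>A sequence indexed by \<open>{n..}\<close>; values of \<open>x\<close> below \<open>n\<close> are irrelevant.\<close>

definition orbit_seq_from :: "('a \<Rightarrow> 'a) \<Rightarrow> int \<Rightarrow> (int \<Rightarrow> 'a) \<Rightarrow> bool" where
  "orbit_seq_from f n x \<longleftrightarrow> (\<forall>k\<ge>n. f (x k) = x (k + 1)) \<and> f -` {x n} = {}"

definition is_orbit :: "('a \<Rightarrow> 'a) \<Rightarrow> 'a set \<Rightarrow> bool" where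
  "is_orbit f S \<longleftrightarrow>
     (\<exists>x. bi_orbit_seq f x \<and> S = range x) \<or>
     (\<exists>n x. orbit_seq_from f n x \<and> S = x ` {n..})"

definition dense :: "'a::topological_space set \<Rightarrow> bool" where
  "dense S \<longleftrightarrow> closure S = UNIV"

definition single_periodic_orbit :: "('a \<Rightarrow> 'a) \<Rightarrow> bool" where
  "single_periodic_orbit f \<longleftrightarrow>
     (\<exists>x. UNIV = forward_orbit f x \<and> (\<exists>p\<ge>1. (f ^^ p) x = x))"

definition isolated_points :: "'a::topological_space set" where
  "isolated_points = {x. open {x}}"

definition cond_IN :: "('a::topological_space \<Rightarrow> 'a) \<Rightarrow> bool" where
  "cond_IN f \<longleftrightarrow>
     \<not> (\<exists>A B. closed A \<and> closed B \<and> A \<noteq> UNIV \<and> B \<noteq> UNIV \<and>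
            plus_invariant f A \<and> plus_invariant f B \<and> A \<union> B = UNIV)"

definition cond_TT :: "('a::topological_space \<Rightarrow> 'a) \<Rightarrow> bool" where
  "cond_TT f \<longleftrightarrow> (\<forall>U V. opene U \<longrightarrow> opene V \<longrightarrow> hit_times f U V \<noteq> {})"

definition cond_TT_p :: "('a::topological_space \<Rightarrow> 'a) \<Rightarrow> bool" where
  "cond_TT_p f \<longleftrightarrow> (\<forall>U V. opene U \<longrightarrow> opene V \<longrightarrow> hit_times_plus f U V \<noteq> {})"

definition cond_TT_pp :: "('a::topological_space \<Rightarrow> 'a) \<Rightarrow> bool" where
  "cond_TT_pp f \<longleftrightarrow> (\<forall>U V. opene U \<longrightarrow> opene V \<longrightarrow> infinite (hit_times_plus f U V))"

definition cond_DO :: "('a::topological_space \<Rightarrow> 'a) \<Rightarrow> bool" where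
  "cond_DO f \<longleftrightarrow> (\<exists>S. is_orbit f S \<and> dense S)"

definition cond_DO_p :: "('a::topological_space \<Rightarrow> 'a) \<Rightarrow> bool" where
  "cond_DO_p f \<longleftrightarrow> (\<exists>x. dense (forward_orbit f x))"

definition cond_DO_pp :: "('a::topological_space \<Rightarrow> 'a) \<Rightarrow> bool" where
  "cond_DO_pp f \<longleftrightarrow> (\<exists>x. omega_limit f x = UNIV)"

definition all_conditions :: "('a::topological_space \<Rightarrow> 'a) \<Rightarrow> bool" where
  "all_conditions f \<longleftrightarrow> cond_IN f \<and> cond_TT f \<and> cond_TT_p f \<and> cond_TT_pp f \<and>
     cond_DO f \<and> cond_DO_p f \<and> cond_DO_pp f"

end

theory Submission
  imports Defs
begin

text \<open>
  Under \<open>TT\<close> any two isolated points are comparable: one is an iterate of the other. Moreover the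
  preimage \<open>P\<close> of an isolated point \<open>x\<close> is open, and two disjoint open subsets of \<open>P\<close> avoiding the
  orbit of \<open>x\<close> can never meet under iteration, so in a Hausdorff space \<open>P\<close> is finite and hence
  consists of isolated points. Consequently an orbit through all isolated points exists: either it
  is the forward orbit of one of them, or some isolated point is not periodic and choosing preimages
  backwards from it forever passes through every isolated point that its forward orbit misses. This
  orbit is dense because an open set missed by the forward orbit of an isolated point \<open>x\<close> contains
  an iterated preimage of \<open>x\<close>.
  Under \<open>TT\<^sub>+\<close> the isolated point must also return to its own preimage, so it is periodic, and its
  finite, hence closed, dense orbit is the whole space.
\<close>

section \<open>Hitting times and density in terms of iterates\<close>

lemma int_mem_hit_times:
  "int n \<in> hit_times f A B \<longleftrightarrow> (\<exists>a\<in>A. (f ^^ n) a \<in> B)"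
  by (cases "n = 0") (auto simp: hit_times_def iter_set_def)

lemma minus_int_mem_hit_times:
  "- int n \<in> hit_times f A B \<longleftrightarrow> (\<exists>b\<in>B. (f ^^ n) b \<in> A)"
  by (auto simp: hit_times_def iter_set_def)

lemma hit_times_plus_eq:
  "hit_times_plus f A B = int ` {n. \<exists>a\<in>A. (f ^^ n) a \<in> B}"
  by (auto simp: hit_times_plus_def int_mem_hit_times elim!: Nats_cases)

lemma hit_times_nonempty_iff:
  "hit_times f A B \<noteq> {} \<longleftrightarrow>
     (\<exists>n. \<exists>a\<in>A. (f ^^ n) a \<in> B) \<or> (\<exists>n. \<exists>b\<in>B. (f ^^ n) b \<in> A)"
proof
  assume "hit_times f A B \<noteq> {}"
  then obtain k where "k \<in> hit_times f A B" by blast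
  then show "(\<exists>n. \<exists>a\<in>A. (f ^^ n) a \<in> B) \<or> (\<exists>n. \<exists>b\<in>B. (f ^^ n) b \<in> A)"
    by (cases k rule: int_cases2) (auto simp: int_mem_hit_times minus_int_mem_hit_times)
qed (metis empty_iff int_mem_hit_times minus_int_mem_hit_times)

lemma cond_TT_p_hits:
  assumes "cond_TT_p f" "open U" "U \<noteq> {}" "open V" "V \<noteq> {}"
  obtains n u where "u \<in> U" "(f ^^ n) u \<in> V"
proof -
  have "hit_times_plus f U V \<noteq> {}" using assms by (simp add: cond_TT_p_def opene_def)
  then show ?thesis using that by (auto simp: hit_times_plus_eq)
qed

lemma cond_TT_hits:
  assumes "cond_TT f" "open U" "U \<noteq> {}" "open V" "V \<noteq> {}"
  obtains n u where "u \<in> U" "(f ^^ n) u \<in> V" | n v where "v \<in> V" "(f ^^ n) v \<in> U"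
proof -
  have "hit_times f U V \<noteq> {}" using assms by (simp add: cond_TT_def opene_def)
  then show ?thesis using that unfolding hit_times_nonempty_iff by metis
qed

lemma dense_iff: "dense S \<longleftrightarrow> (\<forall>U. opene U \<longrightarrow> S \<inter> U \<noteq> {})"
  using dense_intersects_open[of euclidean S] by (simp add: dense_def opene_def)

section \<open>Orbits and orbit sequences\<close>

lemma funpow_mem_forward_orbit [intro]: "(f ^^ n) x \<in> forward_orbit f x"
  by (auto simp: forward_orbit_def)

lemma forward_orbit_periodic:
  assumes "(f ^^ p) x = x" "p \<ge> 1"
  shows "forward_orbit f x = (\<lambda>n. (f ^^ n) x) ` {..<p}"
proof -
  have "(f ^^ n) x = (f ^^ (n mod p)) x" for n
    using assms(1) by (simp add: funpow_mod_eq)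
  then show ?thesis
    using assms(2) by (fastforce simp: forward_orbit_def)
qed

text \<open>Turns a chosen backward history of \<open>y 0\<close> into a bi-infinite orbit: the
  history fills the negative indices, the iterates of \<open>y 0\<close> the others, and both agree
  at index 0.\<close>

lemma is_orbit_backward_seq:
  assumes y: "\<And>n. f (y (Suc n)) = y n"
  shows "is_orbit f (range y \<union> forward_orbit f (y 0))"
proof -
  define x where "x k = (if k \<ge> 0 then (f ^^ nat k) (y 0) else y (nat (- k)))" for k :: int
  have pos: "x (int n) = (f ^^ n) (y 0)" for n by (simp add: x_def)
  have neg: "x (- int n) = y n" for n by (simp add: x_def)
  have "bi_orbit_seq f x"
    unfolding bi_orbit_seq_def
  proof
    fix k :: int
    show "f (x k) = x (k + 1)"
    proof (cases "k \<ge> 0")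
      case True
      then show ?thesis by (simp add: x_def nat_add_distrib)
    next
      case False
      then obtain n where k: "k = - int (Suc n)" by (metis int_cases not_less of_nat_0_le_iff)
      then have "k + 1 = - int n" by simp
      then show ?thesis using k neg y by metis
    qed
  qed
  moreover have "range x = range y \<union> forward_orbit f (y 0)"
  proof
    show "range x \<subseteq> range y \<union> forward_orbit f (y 0)" by (auto simp: x_def)
    have "range y \<subseteq> range x" using neg by (metis image_subsetI rangeI)
    moreover have "forward_orbit f (y 0) \<subseteq> range x"
      unfolding forward_orbit_def using pos by (auto simp flip: pos)
    ultimately show "range y \<union> forward_orbit f (y 0) \<subseteq> range x" by blast
  qed
  ultimately show ?thesis unfolding is_orbit_def by metis
qed

lemma is_orbit_forward_periodic:
  assumes "(f ^^ p) x = x" "p \<ge> 1"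
  shows "is_orbit f (forward_orbit f x)"
proof -
  \<comment> \<open>On the cycle of \<open>x\<close> the map \<open>f ^^ (p - 1)\<close> inverts
    \<open>f\<close>, so its powers give a backward history that never leaves the cycle.\<close>
  define y where "y n = (f ^^ ((p - 1) * n)) x" for n
  have "f (y (Suc n)) = y n" for n
  proof -
    have "f (y (Suc n)) = (f ^^ ((p - 1) * n + p)) x"
      using assms(2) by (cases p) (simp_all add: y_def add.commute)
    then show ?thesis using assms(1) by (simp add: funpow_add y_def)
  qed
  then have "is_orbit f (range y \<union> forward_orbit f (y 0))" by (rule is_orbit_backward_seq)
  moreover have "range y \<union> forward_orbit f (y 0) = forward_orbit f x"
    by (auto simp: y_def)
  ultimately show ?thesis by simp
qed

lemma is_orbit_forward_no_preimage:
  assumes "f -` {x} = {}"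
  shows "is_orbit f (forward_orbit f x)"
proof -
  define y where "y k = (f ^^ nat k) x" for k :: int
  have "orbit_seq_from f 0 y"
    using assms by (simp add: orbit_seq_from_def y_def nat_add_distrib)
  moreover have "forward_orbit f x = y ` {0..}"
    by (auto simp: forward_orbit_def y_def image_iff) (metis atLeast_iff nat_int of_nat_0_le_iff)
  ultimately show ?thesis unfolding is_orbit_def by blast
qed

lemma is_orbit_comparable:
  assumes "is_orbit f S" "a \<in> S" "b \<in> S"
  shows "\<exists>n. (f ^^ n) a = b \<or> (f ^^ n) b = a"
proof -
  have step: "\<exists>n. (f ^^ n) (x i) = x j"
    if "i \<le> j" and x: "\<And>k. k \<ge> i \<Longrightarrow> f (x k) = x (k + 1)" for x and i j :: int
  proof -
    have "(f ^^ n) (x i) = x (i + int n)" for n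
      by (induction n) (simp_all add: x add_ac)
    from this[of "nat (j - i)"] show ?thesis using that(1) by auto
  qed
  \<comment> \<open>Both kinds of orbit sequence are treated at once: \<open>A\<close> is the full
    set of indices or a half-line \<open>{n..}\<close>, and the recursion holds from any index in
    \<open>A\<close> onwards.\<close>
  from assms(1) obtain x and A :: "int set" where S: "S = x ` A"
    and x: "\<And>i k. i \<in> A \<Longrightarrow> k \<ge> i \<Longrightarrow> f (x k) = x (k + 1)"
    unfolding is_orbit_def bi_orbit_seq_def orbit_seq_from_def by fastforce
  obtain i j where "a = x i" "b = x j" "i \<in> A" "j \<in> A" using assms S by blast
  then show ?thesis using step[of i j x] step[of j i x] x by (metis linear)
qed

text \<open>A dense orbit has a term in each of \<open>U\<close> and \<open>V\<close>. Whichever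
  comes first reaches the other, and \<open>hit_times\<close> accepts either direction because it
  allows negative times.\<close>

lemma cond_DO_imp_TT:
  assumes "cond_DO f"
  shows "cond_TT f"
  unfolding cond_TT_def
proof (intro allI impI)
  obtain S where S: "is_orbit f S" "dense S" using assms unfolding cond_DO_def by blast
  fix U V :: "'a set" assume "opene U" "opene V"
  then obtain a b where ab: "a \<in> S" "a \<in> U" "b \<in> S" "b \<in> V"
    using S(2) unfolding dense_iff by blast
  then obtain n where "(f ^^ n) a = b \<or> (f ^^ n) b = a"
    using is_orbit_comparable[OF S(1)] by blast
  then show "hit_times f U V \<noteq> {}" unfolding hit_times_nonempty_iff using ab by blast
qed

section \<open>Isolated points of a transitive system\<close>

lemma open_finite_imp_isolated:
  fixes P :: "'a::t1_space set"
  assumes "open P" "finite P" "y \<in> P"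
  shows "y \<in> isolated_points"
proof -
  have "{y} = P - (P - {y})" using assms(3) by blast
  also have "open \<dots>" by (intro open_Diff finite_imp_closed finite_Diff assms)
  finally show ?thesis by (simp add: isolated_points_def)
qed

lemma isolated_preimage:
  fixes f :: "'a::t2_space \<Rightarrow> 'a"
  assumes cont: "continuous_on UNIV f" and TT: "cond_TT f"
    and x: "x \<in> isolated_points" and y: "f y = x"
  shows "y \<in> isolated_points"
proof -
  define P where "P = f -` {x}"
  have "open P" using cont x by (simp add: P_def isolated_points_def open_vimage)
  \<comment> \<open>Either the orbit of \<open>x\<close> misses \<open>P\<close>, or it meets
    \<open>P\<close> and \<open>x\<close> is periodic; then its orbit is finite, hence
    closed.\<close>
  have "finite (P \<inter> forward_orbit f x) \<and> open (P - forward_orbit f x)"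
  proof (cases "P \<inter> forward_orbit f x = {}")
    case True
    then show ?thesis using \<open>open P\<close> by (simp add: Diff_triv)
  next
    case False
    then obtain z where z: "f z = x" "z \<in> forward_orbit f x" by (auto simp: P_def)
    then obtain n where "z = (f ^^ n) x" by (auto simp: forward_orbit_def)
    then have "finite (forward_orbit f x)"
      using z(1) forward_orbit_periodic[of "Suc n" f x] by simp
    then show ?thesis using \<open>open P\<close> by (auto intro: open_Diff finite_imp_closed)
  qed
  then have fin: "finite (P \<inter> forward_orbit f x)" and op: "open (P - forward_orbit f x)" by auto
  \<comment> \<open>One step from \<open>P\<close> leads to \<open>x\<close>, and from there on the
    point stays in the orbit of \<open>x\<close>.\<close>
  have no_return: "(f ^^ n) a \<notin> P - forward_orbit f x" if a: "a \<in> P" and n: "n \<ge> 1" for a n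
  proof -
    obtain m where "n = Suc m" using n by (cases n) auto
    then have "(f ^^ n) a = (f ^^ m) x" using a by (simp add: P_def funpow_swap1)
    then show ?thesis by auto
  qed
  have "a = b" if ab: "a \<in> P - forward_orbit f x" "b \<in> P - forward_orbit f x" for a b
  proof (rule ccontr)
    assume "a \<noteq> b"
    then obtain U V where UV: "open U" "open V" "a \<in> U" "b \<in> V" "U \<inter> V = {}"
      by (meson hausdorff)
    let ?U = "U \<inter> (P - forward_orbit f x)" and ?V = "V \<inter> (P - forward_orbit f x)"
    have "open ?U" "?U \<noteq> {}" "open ?V" "?V \<noteq> {}" using UV ab op by auto
    \<comment> \<open>A hit at time 0 contradicts disjointness, a hit at a positive time contradicts
      \<open>no_return\<close>.\<close>
    from TT this show False
    proof (cases rule: cond_TT_hits)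
      case (1 n u)
      then show False using no_return[of u n] UV(5) by (cases n) auto
    next
      case (2 n v)
      then show False using no_return[of v n] UV(5) by (cases n) auto
    qed
  qed
  then have "\<exists>q. P - forward_orbit f x \<subseteq> {q}" by blast
  then have "finite (P - forward_orbit f x)" using finite_subset by blast
  with fin have "finite P" by (metis Int_Diff_Un finite_UnI)
  with \<open>open P\<close> show ?thesis by (rule open_finite_imp_isolated) (simp add: P_def y)
qed

lemma isolated_iterated_preimage:
  fixes f :: "'a::t2_space \<Rightarrow> 'a"
  assumes "continuous_on UNIV f" "cond_TT f" "(f ^^ n) y \<in> isolated_points"
  shows "y \<in> isolated_points"
  using assms(3)
proof (induction n)
  case (Suc n)
  then show ?case using isolated_preimage[OF assms(1,2) Suc.prems, of "(f ^^ n) y"] by simp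
qed simp

lemma isolated_comparable:
  assumes "cond_TT f" "x \<in> isolated_points" "y \<in> isolated_points"
  shows "\<exists>n. (f ^^ n) x = y \<or> (f ^^ n) y = x"
  by (rule cond_TT_hits[OF assms(1), of "{x}" "{y}"])
    (use assms(2,3) in \<open>auto simp: isolated_points_def\<close>)

text \<open>The point \<open>x\<close> is supplied along with \<open>S\<close> because the later
  density argument needs the forward orbit of an isolated point inside \<open>S\<close>.\<close>

lemma isolated_subset_orbit:
  fixes f :: "'a::t2_space \<Rightarrow> 'a"
  assumes cont: "continuous_on UNIV f" and TT: "cond_TT f"
    and ne: "(isolated_points :: 'a set) \<noteq> {}"
  shows "\<exists>S x. is_orbit f S \<and> isolated_points \<subseteq> S \<and> x \<in> isolated_points \<and> forward_orbit f x \<subseteq> S"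
proof (cases "\<exists>x\<in>isolated_points. isolated_points \<subseteq> forward_orbit f x")
  case True
  then obtain x where x: "x \<in> isolated_points" "isolated_points \<subseteq> forward_orbit f x" by blast
  have "is_orbit f (forward_orbit f x)"
  proof (cases "f -` {x} = {}")
    case False
    then obtain y where "f y = x" by blast
    then have "y \<in> forward_orbit f x" using isolated_preimage[OF cont TT x(1)] x(2) by blast
    then obtain n where "y = (f ^^ n) x" by (auto simp: forward_orbit_def)
    then have "(f ^^ Suc n) x = x" using \<open>f y = x\<close> by simp
    then show ?thesis by (rule is_orbit_forward_periodic) simp
  qed (rule is_orbit_forward_no_preimage)
  then show ?thesis using x by blast
next
  case False
  \<comment> \<open>The orbit of \<open>y\<close> misses some isolated \<open>z\<close>, so
    comparability forces \<open>z\<close> to reach \<open>y\<close>, and not at time 0.\<close>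
  have pre: "\<exists>z n. z \<in> isolated_points \<and> z \<notin> forward_orbit f y \<and> (f ^^ Suc n) z = y"
    if y: "y \<in> isolated_points" for y
  proof -
    obtain z where z: "z \<in> isolated_points" "z \<notin> forward_orbit f y" using False y by blast
    then obtain n where "(f ^^ n) z = y"
      using isolated_comparable[OF TT y z(1)] by blast
    moreover have "n \<noteq> 0" using calculation z(2) funpow_mem_forward_orbit[of 0 f y] by (cases n) auto
    ultimately show ?thesis using z by (metis not0_implies_Suc)
  qed
  obtain x where x: "x \<in> isolated_points" and nonper: "\<And>p. (f ^^ p) x = x \<Longrightarrow> p = 0"
  proof -
    obtain y :: 'a where "y \<in> isolated_points" using ne by blast
    then obtain z n where z: "z \<in> isolated_points" "z \<notin> forward_orbit f y" "(f ^^ Suc n) z = y"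
      using pre by blast
    \<comment> \<open>If \<open>z\<close> were periodic, \<open>y\<close> would lie on its cycle and
      return to \<open>z\<close>. The multiple \<open>p * Suc n\<close> of the period is large
      enough to subtract the \<open>Suc n\<close> steps from \<open>z\<close> to
      \<open>y\<close>.\<close>
    have "p = 0" if p: "(f ^^ p) z = z" for p
    proof (rule ccontr)
      assume "p \<noteq> 0"
      then have "Suc n \<le> p * Suc n" by (cases p) auto
      then obtain m where m: "p * Suc n = m + Suc n" by (metis add.commute le_Suc_ex)
      have "(f ^^ (p * Suc n)) z = z" using p by (metis funpow_0 funpow_mod_eq mod_mult_self1_is_0)
      then have "(f ^^ m) y = z" using z(3) by (simp only: m funpow_add o_apply)
      then show False using z(2) by auto
    qed
    then show ?thesis using z(1) that by blast
  qed
  have "\<forall>y\<in>isolated_points. \<exists>z. z \<in> isolated_points \<and> f z = y"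
  proof
    fix y :: 'a assume y: "y \<in> isolated_points"
    then obtain z n where z: "f ((f ^^ n) z) = y" using pre by fastforce
    then show "\<exists>z. z \<in> isolated_points \<and> f z = y"
      using isolated_preimage[OF cont TT y] by blast
  qed
  then obtain g where g: "\<And>y. y \<in> isolated_points \<Longrightarrow> g y \<in> isolated_points \<and> f (g y) = y"
    by metis
  \<comment> \<open>Iterating the choice \<open>g\<close> of isolated preimages gives the backward
    history of the non-periodic point \<open>x\<close>.\<close>
  define y where "y n = (g ^^ n) x" for n
  have iso: "y n \<in> isolated_points" for n by (induction n) (auto simp: y_def x g)
  have fy: "f (y (Suc n)) = y n" for n using g[OF iso[of n]] by (simp add: y_def)
  have y0: "y 0 = x" by (simp add: y_def)
  have fny: "(f ^^ n) (y n) = x" for n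
    by (induction n) (simp_all add: y0 fy funpow_Suc_right del: funpow.simps(2))
  define S where "S = range y \<union> forward_orbit f (y 0)"
  have "w \<in> S" if w: "w \<in> isolated_points" for w
  proof -
    obtain n where "(f ^^ n) x = w \<or> (f ^^ n) w = x"
      using isolated_comparable[OF TT x w] by blast
    then show ?thesis
    proof
      assume "(f ^^ n) x = w"
      then show ?thesis by (auto simp: S_def y_def)
    next
      assume wn: "(f ^^ n) w = x"
      \<comment> \<open>Both \<open>w\<close> and \<open>y n\<close> arrive at \<open>x\<close>
        after exactly \<open>n\<close> steps. A delay \<open>m\<close> between them would give
        \<open>(f ^^ m) x = x\<close>, so \<open>m = 0\<close> and they coincide.\<close>
      obtain m where "(f ^^ m) w = y n \<or> (f ^^ m) (y n) = w"
        using isolated_comparable[OF TT w iso] by blast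
      moreover have "m = 0" if m: "(f ^^ m) w = y n"
      proof -
        have "(f ^^ m) x = (f ^^ (m + n)) w" using wn by (simp add: funpow_add)
        also have "\<dots> = (f ^^ n) (y n)" using m by (simp add: funpow_add add.commute[of m])
        finally show ?thesis using nonper by (simp add: fny)
      qed
      moreover have "m = 0" if m: "(f ^^ m) (y n) = w"
      proof -
        have "(f ^^ m) x = (f ^^ (m + n)) (y n)" using fny by (simp add: funpow_add)
        also have "\<dots> = (f ^^ n) w" using m by (simp add: funpow_add add.commute[of m])
        finally show ?thesis using nonper wn by simp
      qed
      ultimately have "w = y n" by auto
      then show ?thesis by (simp add: S_def)
    qed
  qed
  moreover have "is_orbit f S" unfolding S_def using fy by (rule is_orbit_backward_seq)
  moreover have "forward_orbit f x \<subseteq> S" by (simp add: S_def y_def)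
  ultimately show ?thesis using x by blast
qed

lemma cond_TT_dense_orbit:
  fixes f :: "'a::t2_space \<Rightarrow> 'a"
  assumes cont: "continuous_on UNIV f" and TT: "cond_TT f"
    and ne: "(isolated_points :: 'a set) \<noteq> {}"
  shows "\<exists>S. is_orbit f S \<and> isolated_points \<subseteq> S \<and> dense S"
proof -
  obtain S x where S: "is_orbit f S" "isolated_points \<subseteq> S"
    and x: "x \<in> isolated_points" "forward_orbit f x \<subseteq> S"
    using isolated_subset_orbit[OF assms] by blast
  have "S \<inter> V \<noteq> {}" if "opene V" for V
  proof -
    have V: "open V" "V \<noteq> {}" using that by (auto simp: opene_def)
    have "open {x}" "{x} \<noteq> {}" using x(1) by (auto simp: isolated_points_def)
    from TT this V show ?thesis
    proof (cases rule: cond_TT_hits)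
      case (1 n u)
      then show ?thesis using x(2) by auto
    next
      case (2 n v)
      \<comment> \<open>Here \<open>v\<close> reaches the isolated point \<open>x\<close>, so
        \<open>v\<close> is itself isolated and lies in \<open>S\<close>.\<close>
      then show ?thesis using isolated_iterated_preimage[OF cont TT, of n v] x(1) S(2) by auto
    qed
  qed
  then show ?thesis using S dense_iff by blast
qed

section \<open>Forward transitivity forces a periodic orbit\<close>

lemma cond_TT_p_periodic:
  fixes f :: "'a::t2_space \<Rightarrow> 'a"
  assumes cont: "continuous_on UNIV f" and TT: "cond_TT_p f"
    and ne: "(isolated_points :: 'a set) \<noteq> {}"
  shows "finite (UNIV :: 'a set) \<and> single_periodic_orbit f"
proof -
  obtain x :: 'a where x: "open {x}" using ne by (auto simp: isolated_points_def)
  \<comment> \<open>The preimage must be nonempty before transitivity applies to it. In a one-point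
    space \<open>x\<close> is fixed; otherwise the open complement of \<open>x\<close> reaches
    \<open>x\<close>, necessarily at a positive time.\<close>
  have "f -` {x} \<noteq> {}"
  proof (cases "- {x} = {}")
    case True
    then have "f x = x" by blast
    then show ?thesis by blast
  next
    case False
    obtain n u where "u \<in> - {x}" "(f ^^ n) u \<in> {x}"
      by (rule cond_TT_p_hits[OF TT _ False x]) auto
    then show ?thesis by (cases n) auto
  qed
  moreover have "open (f -` {x})" using cont x by (simp add: open_vimage)
  ultimately obtain n where "f ((f ^^ n) x) = x"
    using cond_TT_p_hits[OF TT x, of "f -` {x}"] by auto
  then have per: "(f ^^ Suc n) x = x" by simp
  have fin: "finite (forward_orbit f x)" using forward_orbit_periodic[OF per] by simp
  have "forward_orbit f x \<inter> V \<noteq> {}" if "opene V" for V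
    by (rule cond_TT_p_hits[OF TT x, of V]) (use that in \<open>auto simp: opene_def\<close>)
  then have "closure (forward_orbit f x) = UNIV" by (simp add: dense_iff flip: dense_def)
  then have univ: "UNIV = forward_orbit f x" using fin by (simp add: finite_imp_closed)
  moreover have "Suc n \<ge> 1" by simp
  ultimately show ?thesis using fin per unfolding single_periodic_orbit_def by metis
qed

section \<open>Implications between the conditions\<close>

lemma single_periodic_orbit_imp_DO_pp:
  assumes "single_periodic_orbit f"
  shows "cond_DO_pp f"
proof -
  obtain x p where x: "UNIV = forward_orbit f x" "p \<ge> 1" "(f ^^ p) x = x"
    using assms unfolding single_periodic_orbit_def by blast
  have "y \<in> {(f ^^ k) x |k. k \<ge> n}" for y n
  proof -
    obtain m where "y = (f ^^ m) x" using x(1) by (auto simp: forward_orbit_def)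
    \<comment> \<open>Adding \<open>n\<close> full periods pushes the visit to \<open>y\<close>
      beyond time \<open>n\<close>.\<close>
    then have "y = (f ^^ (m + p * n)) x"
      using x(3) by (metis funpow_mod_eq mod_mult_self2)
    moreover have "m + p * n \<ge> n" using x(2) by (simp add: trans_le_add2)
    ultimately show ?thesis by blast
  qed
  then have "omega_limit f x = UNIV"
    unfolding omega_limit_def using closure_subset by blast
  then show ?thesis unfolding cond_DO_pp_def by blast
qed

lemma omega_limit_UNIV_visits:
  assumes "omega_limit f x = UNIV" "opene U"
  obtains k where "k \<ge> n" "(f ^^ k) x \<in> U"
proof -
  have "dense {(f ^^ k) x |k. k \<ge> n}" using assms(1) by (auto simp: omega_limit_def dense_def)
  then show ?thesis using assms(2) that unfolding dense_iff by blast
qed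

lemma cond_DO_pp_imp_TT_pp:
  assumes "cond_DO_pp f"
  shows "cond_TT_pp f"
  unfolding cond_TT_pp_def
proof (intro allI impI)
  obtain x where x: "omega_limit f x = UNIV" using assms unfolding cond_DO_pp_def by blast
  fix U V :: "'a set" assume U: "opene U" and V: "opene V"
  obtain i where i: "(f ^^ i) x \<in> U" using omega_limit_UNIV_visits[OF x U] by blast
  have "\<exists>n\<ge>m. \<exists>a\<in>U. (f ^^ n) a \<in> V" for m
  proof -
    \<comment> \<open>Time is counted from the visit to \<open>U\<close> at \<open>i\<close>, so the
      bound \<open>m + i\<close> makes the delay \<open>j - i\<close> at least
      \<open>m\<close>.\<close>
    obtain j where j: "j \<ge> m + i" "(f ^^ j) x \<in> V" using omega_limit_UNIV_visits[OF x V] by blast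
    then have "(f ^^ (j - i)) ((f ^^ i) x) \<in> V" by (simp flip: funpow_add[THEN fun_cong, simplified])
    then show ?thesis using i j(1) by (metis add_le_imp_le_diff)
  qed
  then have "infinite {n. \<exists>a\<in>U. (f ^^ n) a \<in> V}" by (simp add: infinite_nat_iff_unbounded_le)
  then show "infinite (hit_times_plus f U V)"
    by (simp add: hit_times_plus_eq finite_image_iff)
qed

lemma cond_DO_pp_imp_DO_p:
  assumes "cond_DO_pp f"
  shows "cond_DO_p f"
proof -
  obtain x where x: "omega_limit f x = UNIV" using assms unfolding cond_DO_pp_def by blast
  have "dense (forward_orbit f x)"
    unfolding dense_iff using omega_limit_UNIV_visits[OF x] by blast
  then show ?thesis unfolding cond_DO_p_def by blast
qed

lemma cond_TT_pp_imp_TT_p: "cond_TT_pp f \<Longrightarrow> cond_TT_p f"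
  unfolding cond_TT_pp_def cond_TT_p_def by (metis finite.emptyI)

lemma cond_TT_p_imp_TT: "cond_TT_p f \<Longrightarrow> cond_TT f"
  unfolding cond_TT_p_def cond_TT_def hit_times_plus_def by blast

text \<open>A point outside \<open>A\<close> lies in the invariant set \<open>B\<close> and can
  never leave it, yet \<open>cond_TT_p\<close> sends some such point out of
  \<open>B\<close>.\<close>

lemma cond_TT_p_imp_IN:
  assumes "cond_TT_p f"
  shows "cond_IN f"
  unfolding cond_IN_def
proof clarify
  fix A B :: "'a set"
  assume AB: "closed A" "closed B" "A \<noteq> UNIV" "B \<noteq> UNIV" "A \<union> B = UNIV" "plus_invariant f B"
  obtain n u where u: "u \<in> - A" "(f ^^ n) u \<in> - B"
    by (rule cond_TT_p_hits[OF assms, of "- A" "- B"]) (use AB in auto)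
  have "(f ^^ n) u \<in> B" for n
    by (induction n) (use u AB in \<open>auto simp: plus_invariant_def\<close>)
  then show False using u by blast
qed

theorem theorem5p1:
  fixes f :: "'a::t2_space \<Rightarrow> 'a"
  assumes "continuous_on UNIV f"
    and "(isolated_points :: 'a set) \<noteq> {}"
  shows "(cond_TT_p f \<longrightarrow> finite (UNIV :: 'a set) \<and> single_periodic_orbit f)
    \<and> (cond_TT_p f \<longleftrightarrow> cond_TT_pp f)
    \<and> (cond_TT_pp f \<longleftrightarrow> cond_DO_pp f)
    \<and> (cond_TT_p f \<longrightarrow> all_conditions f)
    \<and> (cond_TT_pp f \<longrightarrow> all_conditions f)
    \<and> (cond_DO_pp f \<longrightarrow> all_conditions f)
    \<and> (cond_TT f \<longrightarrow> (\<exists>S. is_orbit f S \<and> isolated_points \<subseteq> S \<and> dense S))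
    \<and> (cond_TT f \<longleftrightarrow> cond_DO f)"
proof -
  have periodic: "finite (UNIV :: 'a set) \<and> single_periodic_orbit f" if "cond_TT_p f"
    using cond_TT_p_periodic assms that by blast
  have equiv: "cond_TT_p f \<longleftrightarrow> cond_TT_pp f" "cond_TT_pp f \<longleftrightarrow> cond_DO_pp f"
    using periodic single_periodic_orbit_imp_DO_pp cond_DO_pp_imp_TT_pp cond_TT_pp_imp_TT_p
    by blast+
  have orbit: "\<exists>S. is_orbit f S \<and> isolated_points \<subseteq> S \<and> dense S" if "cond_TT f"
    using cond_TT_dense_orbit assms that by blast
  then have DO: "cond_TT f \<longleftrightarrow> cond_DO f"
    using cond_DO_imp_TT unfolding cond_DO_def by blast
  have "all_conditions f" if "cond_TT_p f"
    unfolding all_conditions_def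
    using that equiv DO cond_TT_p_imp_IN cond_TT_p_imp_TT cond_DO_pp_imp_DO_p by blast
  then show ?thesis using periodic equiv orbit DO by blast
qed

end
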